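(* Let $q$ be a prime power, $e\ge 2$ an integer, $V$ a $(2e+1)$-dimensional vector space over $\mathrm{GF}(q)$, $H$ a hyperplane of $V$, and $\sigma$ a polarity of $H$. Let $([V],\mathcal{A}'\cup\mathcal{B}')$ be the design defined from $V,H,\sigma$ in the context, and let $\tilde{J}_q(2e+1,e)$ be the twisted Grassmann graph defined from $V,H$ in the context. Then $\tilde{J}_q(2e+1,e)$ is isomorphic to the block graph of the design $([V],\mathcal{A}'\cup\mathcal{B}')$, that is, the graph whose vertices are the blocks in $\mathcal{A}'\cup\mathcal{B}'$, where two blocks are adjacent if and only if their intersection has size $(q^e-1)/(q-1)$.
   Context: Let $q$ be a prime power, $e\ge 2$ an integer, $V$ a $(2e+1)$-dimensional vector space over $\mathrm{GF}(q)$, and $H$ a fixed hyperplane of $V$ (a linear subspace of dimension $2e$). Notation. If $W\subseteq V$ is a subset closed under multiplication by elements of $\mathrm{GF}(q)$, then $[W]$ denotes the set of $1$-dimensional subspaces of $V$ contained in $W$. For a vector space $W$, $\genfrac{[}{]}{0pt}{}{W}{k}$ denotes the set of $k$-dimensional subspaces of $W$. Twisted Grassmann graph. The graph $\tilde{J}_q(2e+1,e)$ has vertex set $\mathcal{A}\cup\mathcal{B}$, where $$\mathcal{A}=\left\{W\in\genfrac{[}{]}{0pt}{}{V}{e+1}\;\middle|\; W\not\subset H\right\},\qquad \mathcal{B}=\genfrac{[}{]}{0pt}{}{H}{e-1},$$ with (symmetric) adjacency defined by: for $W_1,W_2\in\mathcal{A}$, $W_1\sim W_2$ iff $\dim (W_1\cap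 W_2)=e$; for $W_1\in\mathcal{A}$, $W_2\in\mathcal{B}$, $W_1\sim W_2$ iff $W_1\supset W_2$; for $W_1,W_2\in\mathcal{B}$, $W_1\sim W_2$ iff $\dim (W_1\cap W_2)=e-2$. Polarity. A polarity $\sigma$ of $H$ is an inclusion-reversing permutation of the set of all linear subspaces of $H$ such that $\sigma^2$ is the identity. The design. The incidence structure $([V],\mathcal{A}'\cup\mathcal{B}')$ has point set $[V]$ and block set $\mathcal{A}'\cup\mathcal{B}'$ (blocks are subsets of $[V]$), where $$\mathcal{A}'=\{[\sigma(W\cap H)\cup(W\setminus H)]\mid W\in\mathcal{A}\},\qquad \mathcal{B}'=\left\{[W]\;\middle|\; W\in\genfrac{[}{]}{0pt}{}{H}{e+1}\right\}.$$ *)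

theory Defs
  imports Complex_Main
    "Graph_Theory.Pair_Digraph"
    "Graph_Theory.Digraph_Isomorphism"
begin

type_synonym ('k, 'v) scaling = "'k \<Rightarrow> 'v \<Rightarrow> 'v"

definition grassmannian ::
    "('k::field, 'v::ab_group_add) scaling \<Rightarrow> 'v set \<Rightarrow> nat \<Rightarrow> 'v set set" where
  "grassmannian scale W k = {U. module.subspace scale U \<and> U \<subseteq> W \<and> vector_space.dim scale U = k}"

text \<open>The set \<open>[W]\<close>; here \<open>W\<close> need not be a subspace.\<close>

definition proj_points ::
    "('k::field, 'v::ab_group_add) scaling \<Rightarrow> 'v set \<Rightarrow> 'v set set" where
  "proj_points scale W = grassmannian scale W 1"

definition twisted_A ::
    "('k::field, 'v::ab_group_add) scaling \<Rightarrow> 'v set \<Rightarrow> nat \<Rightarrow> 'v set set" where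
  "twisted_A scale H e = {W \<in> grassmannian scale UNIV (e + 1). \<not> W \<subseteq> H}"

definition twisted_B ::
    "('k::field, 'v::ab_group_add) scaling \<Rightarrow> 'v set \<Rightarrow> nat \<Rightarrow> 'v set set" where
  "twisted_B scale H e = grassmannian scale H (e - 1)"

text \<open>An undirected graph is represented by a symmetric arc relation. The first and last
  clause are symmetric by themselves; the mixed clause is given in both directions.\<close>

definition twisted_grassmann_graph ::
    "('k::field, 'v::ab_group_add) scaling \<Rightarrow> 'v set \<Rightarrow> nat \<Rightarrow> 'v set pair_pre_digraph" where
  "twisted_grassmann_graph scale H e =
    \<lparr> pverts = twisted_A scale H e \<union> twisted_B scale H e,
      parcs =
        {(W1, W2). W1 \<in> twisted_A scale H e \<and> W2 \<in> twisted_A scale H e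
          \<and> vector_space.dim scale (W1 \<inter> W2) = e}
        \<union> {(W1, W2). W1 \<in> twisted_A scale H e \<and> W2 \<in> twisted_B scale H e \<and> W2 \<subseteq> W1}
        \<union> {(W2, W1). W1 \<in> twisted_A scale H e \<and> W2 \<in> twisted_B scale H e \<and> W2 \<subseteq> W1}
        \<union> {(W1, W2). W1 \<in> twisted_B scale H e \<and> W2 \<in> twisted_B scale H e
          \<and> vector_space.dim scale (W1 \<inter> W2) = e - 2} \<rparr>"

definition polarity ::
    "('k::field, 'v::ab_group_add) scaling \<Rightarrow> 'v set \<Rightarrow> ('v set \<Rightarrow> 'v set) \<Rightarrow> bool" where
  "polarity scale H \<sigma> \<longleftrightarrow>
    bij_betw \<sigma> {U. module.subspace scale U \<and> U \<subseteq> H} {U. module.subspace scale U \<and> U \<subseteq> H} \<and>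
    (\<forall>U1 U2. module.subspace scale U1 \<and> module.subspace scale U2 \<and> U1 \<subseteq> U2 \<and> U2 \<subseteq> H
      \<longrightarrow> \<sigma> U2 \<subseteq> \<sigma> U1) \<and>
    (\<forall>U. module.subspace scale U \<and> U \<subseteq> H \<longrightarrow> \<sigma> (\<sigma> U) = U)"

definition design_A ::
    "('k::field, 'v::ab_group_add) scaling \<Rightarrow> 'v set \<Rightarrow> ('v set \<Rightarrow> 'v set) \<Rightarrow> nat \<Rightarrow> 'v set set set" where
  "design_A scale H \<sigma> e = {proj_points scale (\<sigma> (W \<inter> H) \<union> (W - H)) | W. W \<in> twisted_A scale H e}"

definition design_B ::
    "('k::field, 'v::ab_group_add) scaling \<Rightarrow> 'v set \<Rightarrow> nat \<Rightarrow> 'v set set set" where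
  "design_B scale H e = {proj_points scale W | W. W \<in> grassmannian scale H (e + 1)}"

text \<open>An incidence structure is a pair of a point set and a set of blocks.\<close>

definition polarity_design ::
    "('k::field, 'v::ab_group_add) scaling \<Rightarrow> 'v set \<Rightarrow> ('v set \<Rightarrow> 'v set) \<Rightarrow> nat
      \<Rightarrow> 'v set set \<times> 'v set set set" where
  "polarity_design scale H \<sigma> e = (proj_points scale UNIV, design_A scale H \<sigma> e \<union> design_B scale H e)"

definition block_graph :: "real \<Rightarrow> 'p set \<times> 'p set set \<Rightarrow> 'p set pair_pre_digraph" where
  "block_graph s D =
    \<lparr> pverts = snd D,
      parcs = {(X, Y). X \<in> snd D \<and> Y \<in> snd D \<and> X \<noteq> Y \<and> real (card (X \<inter> Y)) = s} \<rparr>"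

end

theory Submission
  imports Defs "HOL-Library.Cardinality"
begin

text \<open>The isomorphism sends \<open>W \<in> \<A>\<close> to \<open>[\<sigma>(W \<inter> H) \<union> (W \<setminus> H)]\<close> and \<open>W \<in> \<B>\<close> to \<open>[\<sigma>(W)]\<close>.
  A polarity turns sums into intersections and complements dimensions, so by the dimension
  formula \<open>\<sigma>(U\<^sub>1) \<inter> \<sigma>(U\<^sub>2)\<close> has dimension \<open>2e - dim U\<^sub>1 - dim U\<^sub>2 + dim (U\<^sub>1 \<inter> U\<^sub>2)\<close>. If both \<open>U\<^sub>i\<close> have
  dimension \<open>e\<close> this is \<open>dim (U\<^sub>1 \<inter> U\<^sub>2)\<close>: twisting two members of \<open>\<A>\<close> does not change the size of
  their intersection. The cardinalities of intersections thus determine adjacency, and also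
  injectivity.\<close>

section \<open>Counting in vector spaces over a finite field\<close>

lemma card_finite_field_ge_2:
  assumes "finite (UNIV :: 'k::field set)"
  shows "2 \<le> CARD('k)"
proof -
  have "card {0, 1 :: 'k} \<le> CARD('k)"
    using assms by (intro card_mono) auto
  then show ?thesis by simp
qed

context vector_space
begin

text \<open>As \<open>x\<close> lies outside \<open>span S\<close>, each vector of the larger span
  is \<open>scale k x + y\<close> for exactly one scalar \<open>k\<close> and one \<open>y\<close>
  in \<open>span S\<close>.\<close>

lemma card_span_insert:
  assumes "x \<notin> span S"
  shows "card (span (insert x S)) = CARD('a) * card (span S)"
proof -
  let ?f = "\<lambda>(k, y). scale k x + y"
  have "inj_on ?f (UNIV \<times> span S)"
  proof (rule inj_onI, clarify)
    fix k y l z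
    assume y: "y \<in> span S" and z: "z \<in> span S" and eq: "scale k x + y = scale l x + z"
    have *: "scale (k - l) x = z - y"
      using eq by (simp add: scale_left_diff_distrib algebra_simps)
    have "k = l"
    proof (rule ccontr)
      assume "k \<noteq> l"
      then have "x = scale (inverse (k - l)) (z - y)"
        by (simp flip: *)
      then show False
        using assms y z by (metis span_diff span_scale)
    qed
    with eq show "k = l \<and> y = z" by simp
  qed
  moreover have "?f ` (UNIV \<times> span S) = span (insert x S)"
  proof (intro equalityI subsetI)
    fix v assume "v \<in> span (insert x S)"
    then obtain k where "v - scale k x \<in> span S"
      by (auto simp: span_insert)
    then show "v \<in> ?f ` (UNIV \<times> span S)"
      by (intro image_eqI[where x = "(k, v - scale k x)"]) auto
  next
    fix v assume "v \<in> ?f ` (UNIV \<times> span S)"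
    then obtain k y where "v = scale k x + y" "y \<in> span S"
      by auto
    then have "v - scale k x \<in> span S"
      by simp
    then show "v \<in> span (insert x S)"
      by (auto simp: span_insert)
  qed
  ultimately have "bij_betw ?f (UNIV \<times> span S) (span (insert x S))"
    by (simp add: bij_betw_def)
  then show ?thesis
    by (metis bij_betw_same_card card_cartesian_product)
qed

lemma card_span_independent:
  assumes "finite B" "independent B"
  shows "card (span B) = CARD('a) ^ card B"
  using assms
proof (induction B rule: finite_induct)
  case (insert x B)
  then show ?case
    by (simp add: independent_insert card_span_insert)
qed simp

end

context finite_dimensional_vector_space
begin

lemma card_subspace:
  assumes "subspace U"
  shows "card U = CARD('a) ^ dim U"
proof -
  obtain B where B: "B \<subseteq> U" "independent B" "U \<subseteq> span B" "card B = dim U"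
    using basis_exists by blast
  then have "span B = U"
    using assms by (intro span_subspace)
  then show ?thesis
    using B card_span_independent[of B] finiteI_independent by simp
qed

lemma finite_vectors:
  assumes "finite (UNIV :: 'a set)"
  shows "finite (X :: 'b set)"
proof -
  \<comment> \<open>A positive \<open>card\<close> certifies finiteness, because infinite sets have
    \<open>card\<close> 0.\<close>
  have "card (UNIV :: 'b set) > 0"
    using card_subspace[of UNIV] assms by (simp add: card_gt_0_iff)
  then show ?thesis
    by (metis card_gt_0_iff finite_subset subset_UNIV)
qed

lemma one_dim_eq_span:
  assumes "subspace U" "dim U = 1" "x \<in> U" "x \<noteq> 0"
  shows "U = span {x}"
  using assms subspace_dim_equal[of "span {x}" U] span_minimal[of "{x}" U] by simp

lemma dim_lt_of_psubset:
  assumes "subspace S" "subspace T" "S \<subset> T"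
  shows "dim S < dim T"
  using assms dim_psubset[of S T] by (simp add: span_eq_iff[THEN iffD2])

lemma dim_eq_of_subset_iff:
  assumes "subspace S" "subspace T" "S \<subseteq> T"
  shows "dim S = dim T \<longleftrightarrow> S = T"
  using assms subspace_dim_equal[of S T] by auto

text \<open>The lines inside a cone \<open>X\<close> meet pairwise only in 0 and cover it; without 0
  each has \<open>CARD('a) - 1\<close> vectors. The setting is that of cones since twisted sets need
  not be subspaces.\<close>

lemma card_proj_points:
  assumes fin: "finite (UNIV :: 'a set)"
    and zero: "0 \<in> X" and cone: "\<And>c x. x \<in> X \<Longrightarrow> scale c x \<in> X"
  shows "(CARD('a) - 1) * card (proj_points scale X) = card X - 1"
proof -
  have P: "U \<in> proj_points scale X \<longleftrightarrow> subspace U \<and> U \<subseteq> X \<and> dim U = 1" for U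
    by (simp add: proj_points_def grassmannian_def)
  have finv: "finite Y" for Y :: "'b set"
    using finite_vectors[OF fin] .
  have "X - {0} = (\<Union>U\<in>proj_points scale X. U - {0})"
  proof (intro equalityI subsetI)
    fix x assume x: "x \<in> X - {0}"
    have "span {x} \<subseteq> X"
      using x cone by (auto simp: span_singleton)
    then have "span {x} \<in> proj_points scale X"
      using x by (simp add: P)
    moreover have "x \<in> span {x}"
      by (simp add: span_base)
    ultimately show "x \<in> (\<Union>U\<in>proj_points scale X. U - {0})"
      using x by blast
  qed (auto simp: P)
  also have "card \<dots> = (\<Sum>U\<in>proj_points scale X. card (U - {0}))"
  proof (rule card_UN_disjoint)
    show "finite (proj_points scale X)"
      by (rule finite_subset[of _ "Pow X"]) (auto simp: P finv)
    show "\<forall>U\<in>proj_points scale X. \<forall>U'\<in>proj_points scale X.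
        U \<noteq> U' \<longrightarrow> (U - {0}) \<inter> (U' - {0}) = {}"
    proof (intro ballI impI, rule ccontr)
      fix U U' assume U: "U \<in> proj_points scale X" "U' \<in> proj_points scale X" "U \<noteq> U'"
      assume "(U - {0}) \<inter> (U' - {0}) \<noteq> {}"
      then obtain x where "x \<in> U" "x \<in> U'" "x \<noteq> 0" by blast
      then have "U = span {x}" "U' = span {x}"
        using U by (metis P one_dim_eq_span)+
      with U show False by simp
    qed
  qed (simp add: finv)
  also have "\<dots> = (\<Sum>U\<in>proj_points scale X. CARD('a) - 1)"
  proof (rule sum.cong)
    fix U assume "U \<in> proj_points scale X"
    then show "card (U - {0}) = CARD('a) - 1"
      using card_subspace[of U] subspace_0[of U] by (simp add: P finv)
  qed simp
  finally show ?thesis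
    using zero by (simp add: finv mult.commute)
qed

text \<open>Turns the real quotient of the block graph into a count of vectors. The exponent
  \<open>k\<close> stays free: it is \<open>e\<close> for adjacency and \<open>e + 1\<close> for
  equality of vertices.\<close>

lemma card_proj_points_eq_iff:
  assumes fin: "finite (UNIV :: 'a set)"
    and zero: "0 \<in> X" and cone: "\<And>c x. x \<in> X \<Longrightarrow> scale c x \<in> X"
  shows "real (card (proj_points scale X)) = (real CARD('a) ^ k - 1) / (real CARD('a) - 1)
    \<longleftrightarrow> card X = CARD('a) ^ k"
proof -
  have q: "2 \<le> CARD('a)"
    using card_finite_field_ge_2[OF fin] .
  \<comment> \<open>Both \<open>card X\<close> and \<open>CARD('a)\<close> are at least 1, so the
    truncated subtractions in \<open>card_proj_points\<close> agree with those over the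
    reals.\<close>
  have "card X > 0"
    using zero finite_vectors[OF fin] by (auto simp: card_gt_0_iff)
  moreover have "real ((CARD('a) - 1) * card (proj_points scale X)) = real (card X - 1)"
    using card_proj_points[OF assms] by simp
  ultimately have "(real CARD('a) - 1) * card (proj_points scale X) = real (card X) - 1"
    using q by (simp add: of_nat_diff)
  moreover have "real CARD('a) - 1 \<noteq> 0"
    using q by linarith
  ultimately have "real (card (proj_points scale X)) = (real CARD('a) ^ k - 1) / (real CARD('a) - 1)
    \<longleftrightarrow> real (card X) = real (CARD('a) ^ k)"
    by (auto simp: field_simps)
  then show ?thesis by (simp only: of_nat_eq_iff)
qed

section \<open>Polarities\<close>

lemma polarity_subspace:
  assumes "polarity scale H \<sigma>" "subspace U" "U \<subseteq> H"
  shows "subspace (\<sigma> U)" "\<sigma> U \<subseteq> H" "\<sigma> (\<sigma> U) = U"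
proof -
  have "\<sigma> U \<in> {U. subspace U \<and> U \<subseteq> H}"
    using assms by (intro bij_betw_apply[of \<sigma> "{U. subspace U \<and> U \<subseteq> H}"]) (auto simp: polarity_def)
  then show "subspace (\<sigma> U)" "\<sigma> U \<subseteq> H"
    by auto
  show "\<sigma> (\<sigma> U) = U"
    using assms by (simp add: polarity_def)
qed

lemma polarity_antimono:
  assumes "polarity scale H \<sigma>" "subspace U" "subspace U'" "U \<subseteq> U'" "U' \<subseteq> H"
  shows "\<sigma> U' \<subseteq> \<sigma> U"
  using assms unfolding polarity_def by blast

text \<open>Strictness comes from the involution: equal images would give \<open>U = U'\<close>
  after a second application of \<open>\<sigma>\<close>.\<close>

lemma polarity_strict_antimono:
  assumes "polarity scale H \<sigma>" "subspace U" "subspace U'" "U \<subset> U'" "U' \<subseteq> H"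
  shows "\<sigma> U' \<subset> \<sigma> U"
  using assms polarity_antimono[of H \<sigma> U U'] polarity_subspace(3)[of H \<sigma>]
  by (metis order.trans psubset_eq)

text \<open>A strictly decreasing map on subspaces lowers the dimension by at least one at each step of
  a flag: going down from \<open>U\<close> to \<open>0\<close> gives the upper bound, going up from \<open>U\<close> to \<open>H\<close> the lower one.\<close>

lemma dim_polarity:
  assumes pol: "polarity scale H \<sigma>" and H: "subspace H" and "subspace U" "U \<subseteq> H"
  shows "dim (\<sigma> U) + dim U = dim H"
proof (rule antisym)
  show "dim (\<sigma> U) + dim U \<le> dim H"
    using assms(3,4)
  proof (induction "dim U" arbitrary: U)
    case 0
    then show ?case
      using polarity_subspace(2)[OF pol 0(2,3)] dim_subset[of "\<sigma> U" H] by linarith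
  next
    case (Suc n)
    obtain U' where U': "subspace U'" "U' \<subseteq> span U" "dim U' = n"
      using choose_subspace_of_subspace[of n U] Suc.hyps(2) by auto
    then have "U' \<subset> U"
      using Suc.prems Suc.hyps(2) by (metis less_irrefl lessI psubsetI span_eq_iff)
    then have "dim (\<sigma> U) < dim (\<sigma> U')"
      using U' Suc.prems
      by (intro dim_lt_of_psubset polarity_subspace(1)[OF pol] polarity_strict_antimono[OF pol]) auto
    moreover have "dim (\<sigma> U') + dim U' \<le> dim H"
      using Suc.hyps(1)[of U'] U' Suc.prems \<open>U' \<subset> U\<close> by auto
    ultimately show ?case
      using U' Suc.hyps(2) by simp
  qed
  show "dim H \<le> dim (\<sigma> U) + dim U"
    using assms(3,4)
  proof (induction "dim H - dim U" arbitrary: U)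
    case 0
    then show ?case by simp
  next
    case (Suc n)
    then have "U \<noteq> H" by auto
    then obtain x where x: "x \<in> H" "x \<notin> U"
      using Suc.prems by blast
    let ?U' = "span (insert x U)"
    have dU': "dim ?U' = dim U + 1"
      using x Suc.prems dim_insert[of x U] by (simp add: span_eq_iff[THEN iffD2])
    have sub: "?U' \<subseteq> H"
      using x Suc.prems H by (intro span_minimal) auto
    have "U \<subset> ?U'"
      using x by (auto intro: span_base)
    then have "dim (\<sigma> ?U') < dim (\<sigma> U)"
      using Suc.prems sub
      by (intro dim_lt_of_psubset polarity_subspace(1)[OF pol] polarity_strict_antimono[OF pol]) auto
    moreover have "dim H \<le> dim (\<sigma> ?U') + dim ?U'"
      using Suc.hyps(2) dU' sub by (intro Suc.hyps(1)) auto
    ultimately show ?case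
      using dU' by simp
  qed
qed

text \<open>An order-reversing involution of the lattice of subspaces exchanges joins and meets. For
  the harder inclusion, \<open>\<sigma>\<close> of the intersection contains \<open>S\<close> and
  \<open>T\<close>, hence their sum; applying \<open>\<sigma>\<close> once more reverses
  this.\<close>

lemma polarity_sums:
  assumes pol: "polarity scale H \<sigma>" and H: "subspace H"
    and S: "subspace S" "S \<subseteq> H" and T: "subspace T" "T \<subseteq> H"
  shows "\<sigma> {x + y |x y. x \<in> S \<and> y \<in> T} = \<sigma> S \<inter> \<sigma> T" (is "\<sigma> ?ST = _")
proof
  have ST: "subspace ?ST" "?ST \<subseteq> H"
    using subspace_sums S T H by (auto intro: subspace_add)
  have "S \<subseteq> ?ST" "T \<subseteq> ?ST"
    using S T by (force intro: subspace_0)+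
  then show "\<sigma> ?ST \<subseteq> \<sigma> S \<inter> \<sigma> T"
    using polarity_antimono[OF pol] S T ST by blast
  let ?I = "\<sigma> S \<inter> \<sigma> T"
  note \<sigma>S = polarity_subspace[OF pol S] and \<sigma>T = polarity_subspace[OF pol T]
  have I: "subspace ?I" "?I \<subseteq> H"
    using \<sigma>S \<sigma>T by (auto intro: subspace_inter)
  have "S \<subseteq> \<sigma> ?I" "T \<subseteq> \<sigma> ?I"
    using polarity_antimono[OF pol I(1) \<sigma>S(1)] polarity_antimono[OF pol I(1) \<sigma>T(1)] \<sigma>S \<sigma>T by auto
  then have "?ST \<subseteq> \<sigma> ?I"
    using polarity_subspace(1)[OF pol I] by (auto intro: subspace_add)
  then show "?I \<subseteq> \<sigma> ?ST"
    using polarity_antimono[OF pol ST(1) polarity_subspace(1)[OF pol I]]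
      polarity_subspace(2,3)[OF pol I] by auto
qed

text \<open>\<open>dim_polarity\<close> for the sum of \<open>S\<close> and \<open>T\<close>,
  combined with the dimension formula. The additive form avoids truncated subtraction.\<close>

lemma dim_polarity_Int:
  assumes pol: "polarity scale H \<sigma>" and H: "subspace H"
    and S: "subspace S" "S \<subseteq> H" and T: "subspace T" "T \<subseteq> H"
  shows "dim (\<sigma> S \<inter> \<sigma> T) + dim S + dim T = dim H + dim (S \<inter> T)"
proof -
  let ?ST = "{x + y |x y. x \<in> S \<and> y \<in> T}"
  have ST: "subspace ?ST" "?ST \<subseteq> H"
    using subspace_sums S T H by (auto intro: subspace_add)
  have "dim (\<sigma> S \<inter> \<sigma> T) + dim ?ST = dim H"
    using dim_polarity[OF pol H ST] unfolding polarity_sums[OF assms] .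
  then show ?thesis
    using dim_sums_Int[OF S(1) T(1)] by linarith
qed

text \<open>The sum of \<open>W\<close> and \<open>H\<close> strictly contains \<open>H\<close>, so
  it has the dimension of the whole space; the dimension formula gives the rest.\<close>

lemma dim_Int_hyperplane:
  assumes "subspace H" "dim H + 1 = dim (UNIV :: 'b set)" "subspace W" "\<not> W \<subseteq> H"
  shows "dim (W \<inter> H) + 1 = dim W"
proof -
  let ?S = "{x + y |x y. x \<in> W \<and> y \<in> H}"
  have S: "subspace ?S"
    using assms subspace_sums by blast
  have "0 \<in> H" "0 \<in> W"
    using assms subspace_0 by auto
  then have "H \<subseteq> ?S" "W \<subseteq> ?S"
    by force+
  then have "H \<subset> ?S"
    using assms(4) by blast
  then have "dim H < dim ?S"
    using dim_lt_of_psubset assms S by blast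
  moreover have "dim ?S \<le> dim (UNIV :: 'b set)"
    by (rule dim_subset) simp
  ultimately show ?thesis
    using dim_sums_Int[of W H] assms by linarith
qed

end

section \<open>The isomorphism\<close>

text \<open>Arcs are pairs of vertices here, so a vertex bijection \<open>f\<close> determines the
  arc map \<open>map_prod f f\<close>. Since all arcs end in vertices, the equivalence on pairs of
  vertices makes this map a bijection of arcs.\<close>

lemma digraph_iso_with_projI:
  assumes "inj_on f (pverts G)" "f ` pverts G = pverts G'"
    and "parcs G \<subseteq> pverts G \<times> pverts G" "parcs G' \<subseteq> pverts G' \<times> pverts G'"
    and arcs: "\<And>u v. u \<in> pverts G \<Longrightarrow> v \<in> pverts G \<Longrightarrow> (u, v) \<in> parcs G \<longleftrightarrow> (f u, f v) \<in> parcs G'"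
  shows "digraph_iso (with_proj G) (with_proj G')"
  unfolding digraph_iso_def
proof (intro exI conjI)
  let ?h = "\<lparr>iso_verts = f, iso_arcs = map_prod f f, iso_head = snd, iso_tail = fst\<rparr>"
  have "wf_digraph (with_proj G)"
    using assms(3) by unfold_locales auto
  moreover have "inj_on (map_prod f f) (parcs G)"
    using inj_on_subset[OF map_prod_inj_on[OF assms(1,1)] assms(3)] .
  ultimately show "pre_digraph.digraph_isomorphism (with_proj G) ?h"
    using assms(1) by (simp add: pre_digraph.digraph_isomorphism_def)
  have "map_prod f f ` parcs G = parcs G'"
  proof (intro equalityI subsetI)
    fix a assume a: "a \<in> parcs G'"
    then have "a \<in> f ` pverts G \<times> f ` pverts G"
      using assms(4) unfolding assms(2) by (rule subsetD[rotated])
    then obtain u v where "a = (f u, f v)" "u \<in> pverts G" "v \<in> pverts G"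
      by auto
    moreover from this have "(u, v) \<in> parcs G"
      using a arcs by simp
    ultimately show "a \<in> map_prod f f ` parcs G"
      by (metis imageI map_prod_simp)
  qed (use assms(3) arcs in auto)
  then show "with_proj G' = app_iso ?h (with_proj G)"
    using assms(2) by (simp add: app_iso_def with_proj_def)
qed

section \<open>Twisted sets and their closure under scaling\<close>

text \<open>One formula for both kinds of vertices: for \<open>W\<close> inside \<open>H\<close> the
  second part is empty and \<open>\<sigma> W\<close> remains.\<close>

definition twist :: "'v set \<Rightarrow> ('v set \<Rightarrow> 'v set) \<Rightarrow> 'v set \<Rightarrow> 'v set" where
  "twist H \<sigma> W = \<sigma> (W \<inter> H) \<union> (W - H)"

locale twisted_setting = finite_dimensional_vector_space scale Basis
  for scale :: "'k::{field,finite} \<Rightarrow> 'v::ab_group_add \<Rightarrow> 'v" and Basis +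
  fixes H :: "'v set" and \<sigma> :: "'v set \<Rightarrow> 'v set" and e :: nat
  assumes e: "e \<ge> 2"
    and dimV: "dim (UNIV :: 'v set) = 2 * e + 1"
    and H: "subspace H" and dimH: "dim H = 2 * e"
    and pol: "polarity scale H \<sigma>"
begin

abbreviation "\<A> \<equiv> twisted_A scale H e"
abbreviation "\<B> \<equiv> twisted_B scale H e"

lemma twisted_A_D:
  assumes "W \<in> \<A>"
  shows "subspace W" "dim W = e + 1" "\<not> W \<subseteq> H"
    "subspace (W \<inter> H)" "W \<inter> H \<subseteq> H" "dim (W \<inter> H) = e"
proof -
  show W: "subspace W" "dim W = e + 1" "\<not> W \<subseteq> H"
    using assms by (auto simp: twisted_A_def grassmannian_def)
  then show "subspace (W \<inter> H)" "dim (W \<inter> H) = e"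
    using H dim_Int_hyperplane[of H W] dimV dimH by (auto intro: subspace_inter)
qed simp

text \<open>As \<open>e \<ge> 2\<close>, the truncated \<open>e - 1\<close> can be traded for an
  additive equation, fit for linear arithmetic.\<close>

lemma twisted_B_D:
  assumes "W \<in> \<B>"
  shows "subspace W" "W \<subseteq> H" "dim W + 1 = e"
  using assms e by (auto simp: twisted_B_def grassmannian_def)

lemma twist_B: "W \<in> \<B> \<Longrightarrow> twist H \<sigma> W = \<sigma> W"
  using twisted_B_D(2)[of W] by (simp add: twist_def Int_absorb2 Diff_eq_empty_iff[THEN iffD2])

text \<open>Provides the hypotheses for counting points. A nonzero multiple of a vector outside
  \<open>H\<close> stays outside \<open>H\<close>, as scaling back by the inverse shows.\<close>

lemma twist_cone:
  assumes "W \<in> \<A> \<union> \<B>"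
  shows "0 \<in> twist H \<sigma> W" "x \<in> twist H \<sigma> W \<Longrightarrow> scale c x \<in> twist H \<sigma> W"
proof -
  have W: "subspace W" "subspace (W \<inter> H)"
    using assms twisted_A_D twisted_B_D H by (auto intro: subspace_inter)
  then have \<sigma>W: "subspace (\<sigma> (W \<inter> H))"
    using polarity_subspace(1)[OF pol] by simp
  then show "0 \<in> twist H \<sigma> W"
    by (simp add: twist_def subspace_0)
  assume x: "x \<in> twist H \<sigma> W"
  show "scale c x \<in> twist H \<sigma> W"
  \<comment> \<open>The scalar 0 moves a vector of \<open>W - H\<close> to 0, which lies in the
    polar part; hence it joins that case.\<close>
  proof (cases "c = 0 \<or> x \<in> \<sigma> (W \<inter> H)")
    case True
    then show ?thesis
      using \<sigma>W by (auto simp: twist_def subspace_0 subspace_scale)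
  next
    case False
    then have "x \<in> W - H" "c \<noteq> 0"
      using x by (auto simp: twist_def)
    moreover have "scale c x \<notin> H"
      using subspace_scale[OF H, of "scale c x" "inverse c"] calculation by auto
    ultimately show ?thesis
      using W by (simp add: twist_def subspace_scale)
  qed
qed

section \<open>Sizes of intersections of twisted sets\<close>

text \<open>The intersection splits into a part inside \<open>H\<close> and a part outside. The
  twist leaves the latter alone and preserves the size of the former, so the comparison is between
  cardinalities, not subspaces.\<close>

lemma card_twist_AA:
  assumes "W1 \<in> \<A>" "W2 \<in> \<A>"
  shows "card (twist H \<sigma> W1 \<inter> twist H \<sigma> W2) = CARD('k) ^ dim (W1 \<inter> W2)"
proof -
  note W1 = twisted_A_D[OF assms(1)] and W2 = twisted_A_D[OF assms(2)]
  note \<sigma>1 = polarity_subspace[OF pol W1(4,5)] and \<sigma>2 = polarity_subspace[OF pol W2(4,5)]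
  have fin: "finite X" for X :: "'v set"
    by (rule finite_vectors) simp
  \<comment> \<open>Both traces on \<open>H\<close> have dimension \<open>e\<close>, half of
    \<open>dim H\<close>, so the correction 2e - e - e vanishes.\<close>
  have "dim (\<sigma> (W1 \<inter> H) \<inter> \<sigma> (W2 \<inter> H)) = dim ((W1 \<inter> H) \<inter> (W2 \<inter> H))"
    using dim_polarity_Int[OF pol H W1(4,5) W2(4,5)] W1(6) W2(6) dimH by simp
  then have "card (\<sigma> (W1 \<inter> H) \<inter> \<sigma> (W2 \<inter> H)) = card ((W1 \<inter> H) \<inter> (W2 \<inter> H))"
    using \<sigma>1 \<sigma>2 W1 W2 by (simp add: card_subspace subspace_inter)
  moreover have "twist H \<sigma> W1 \<inter> twist H \<sigma> W2
      = (\<sigma> (W1 \<inter> H) \<inter> \<sigma> (W2 \<inter> H)) \<union> (W1 \<inter> W2 - H)"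
    using \<sigma>1 \<sigma>2 by (auto simp: twist_def)
  moreover have "W1 \<inter> W2 = ((W1 \<inter> H) \<inter> (W2 \<inter> H)) \<union> (W1 \<inter> W2 - H)"
    by auto
  moreover have "card ((\<sigma> (W1 \<inter> H) \<inter> \<sigma> (W2 \<inter> H)) \<union> (W1 \<inter> W2 - H))
      = card (\<sigma> (W1 \<inter> H) \<inter> \<sigma> (W2 \<inter> H)) + card (W1 \<inter> W2 - H)"
    using \<sigma>1 by (intro card_Un_disjoint fin) auto
  moreover have "card (((W1 \<inter> H) \<inter> (W2 \<inter> H)) \<union> (W1 \<inter> W2 - H))
      = card ((W1 \<inter> H) \<inter> (W2 \<inter> H)) + card (W1 \<inter> W2 - H)"
    by (intro card_Un_disjoint fin) auto
  ultimately have "card (twist H \<sigma> W1 \<inter> twist H \<sigma> W2) = card (W1 \<inter> W2)"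
    by metis
  then show ?thesis
    using W1 W2 by (simp add: card_subspace subspace_inter)
qed

text \<open>Since \<open>\<sigma> W2\<close> lies in \<open>H\<close>, the part of \<open>W1\<close>
  outside \<open>H\<close> drops out. The offset is 2e - e - (e - 1) = 1.\<close>

lemma card_twist_AB:
  assumes "W1 \<in> \<A>" "W2 \<in> \<B>"
  shows "card (twist H \<sigma> W1 \<inter> twist H \<sigma> W2) = CARD('k) ^ (dim (W1 \<inter> W2) + 1)"
proof -
  note W1 = twisted_A_D[OF assms(1)] and W2 = twisted_B_D[OF assms(2)]
  note \<sigma>1 = polarity_subspace[OF pol W1(4,5)] and \<sigma>2 = polarity_subspace[OF pol W2(1,2)]
  have "W1 \<inter> H \<inter> W2 = W1 \<inter> W2"
    using W2 by auto
  then have "dim (\<sigma> (W1 \<inter> H) \<inter> \<sigma> W2) = dim (W1 \<inter> W2) + 1"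
    using dim_polarity_Int[OF pol H W1(4,5) W2(1,2)] W1(6) W2(3) dimH by simp
  moreover have "twist H \<sigma> W1 \<inter> twist H \<sigma> W2 = \<sigma> (W1 \<inter> H) \<inter> \<sigma> W2"
    using \<sigma>2 twist_B[OF assms(2)] by (auto simp: twist_def)
  ultimately show ?thesis
    using \<sigma>1 \<sigma>2 by (simp add: card_subspace subspace_inter)
qed

text \<open>Here the offset is 2e - 2(e - 1) = 2.\<close>

lemma card_twist_BB:
  assumes "W1 \<in> \<B>" "W2 \<in> \<B>"
  shows "card (twist H \<sigma> W1 \<inter> twist H \<sigma> W2) = CARD('k) ^ (dim (W1 \<inter> W2) + 2)"
proof -
  note W1 = twisted_B_D[OF assms(1)] and W2 = twisted_B_D[OF assms(2)]
  note \<sigma>1 = polarity_subspace[OF pol W1(1,2)] and \<sigma>2 = polarity_subspace[OF pol W2(1,2)]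
  have "dim (\<sigma> W1 \<inter> \<sigma> W2) = dim (W1 \<inter> W2) + 2"
    using dim_polarity_Int[OF pol H W1(1,2) W2(1,2)] W1(3) W2(3) dimH by simp
  then show ?thesis
    using \<sigma>1 \<sigma>2 twist_B assms by (simp add: card_subspace subspace_inter)
qed

lemma card_power_eq_iff: "CARD('k) ^ m = CARD('k) ^ n \<longleftrightarrow> m = n"
  using card_finite_field_ge_2[where 'k = 'k] by (simp add: power_inject_exp)

section \<open>Equality and adjacency read off from intersection sizes\<close>

text \<open>Keeps the exponent of a mixed pair below \<open>e + 1\<close>, the exponent of
  equality.\<close>

lemma dim_Int_less_twisted_B:
  assumes "W1 \<in> \<A>" "W2 \<in> \<B>"
  shows "dim (W1 \<inter> W2) + 1 \<le> e"
  using twisted_B_D[OF assms(2)] dim_subset[of "W1 \<inter> W2" W2] by simp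

text \<open>Every twisted set has \<open>CARD('k) ^ (e + 1)\<close> vectors. With offsets 0 and 2,
  exponent \<open>e + 1\<close> means dimension \<open>e + 1\<close> in \<A> and
  \<open>e - 1\<close> in \<B>, the full dimension in each case; mixed pairs never reach it.\<close>

lemma twisted_eq_iff:
  assumes "W1 \<in> \<A> \<union> \<B>" "W2 \<in> \<A> \<union> \<B>"
  shows "W1 = W2 \<longleftrightarrow> card (twist H \<sigma> W1 \<inter> twist H \<sigma> W2) = CARD('k) ^ (e + 1)"
proof -
  have eq_iff: "W1 = W2 \<longleftrightarrow> dim (W1 \<inter> W2) = n"
    if "subspace W1" "subspace W2" "dim W1 = n" "dim W2 = n" for n
  proof
    assume "dim (W1 \<inter> W2) = n"
    then have "W1 \<inter> W2 = W1" "W1 \<inter> W2 = W2"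
      using that by (simp_all add: subspace_inter flip: dim_eq_of_subset_iff)
    then show "W1 = W2" by simp
  qed (use that in simp)
  have ne: "W \<noteq> W'" if "W \<in> \<A>" "W' \<in> \<B>" for W W'
    using twisted_A_D[OF that(1)] twisted_B_D[OF that(2)] by auto
  consider "W1 \<in> \<A>" "W2 \<in> \<A>" | "W1 \<in> \<A>" "W2 \<in> \<B>" | "W1 \<in> \<B>" "W2 \<in> \<A>" | "W1 \<in> \<B>" "W2 \<in> \<B>"
    using assms by auto
  then show ?thesis
  proof cases
    case 1
    then show ?thesis
      unfolding card_twist_AA[OF 1] card_power_eq_iff
      by (intro eq_iff) (auto simp: twisted_A_D)
  next
    case 2
    then show ?thesis
      unfolding card_twist_AB[OF 2] card_power_eq_iff
      using ne dim_Int_less_twisted_B[OF 2] by auto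
  next
    case 3
    then show ?thesis
      unfolding Int_commute[of "twist H \<sigma> W1"] card_twist_AB[OF 3(2,1)] card_power_eq_iff
      using ne dim_Int_less_twisted_B[OF 3(2,1)] by auto
  next
    case 4
    have "W1 = W2 \<longleftrightarrow> dim (W1 \<inter> W2) = e - 1"
      using twisted_B_D[OF 4(1)] twisted_B_D[OF 4(2)] by (intro eq_iff) auto
    then show ?thesis
      unfolding card_twist_BB[OF 4] card_power_eq_iff
      using e by auto
  qed
qed

lemma adjacent_AB_iff:
  assumes "W1 \<in> \<A>" "W2 \<in> \<B>"
  shows "W2 \<subseteq> W1 \<longleftrightarrow> card (twist H \<sigma> W1 \<inter> twist H \<sigma> W2) = CARD('k) ^ e"
proof -
  note W2 = twisted_B_D[OF assms(2)]
  have "W2 \<subseteq> W1 \<longleftrightarrow> dim (W1 \<inter> W2) = dim W2"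
    using twisted_A_D(1)[OF assms(1)] W2 dim_eq_of_subset_iff[of "W1 \<inter> W2" W2]
    by (auto simp: subspace_inter)
  then show ?thesis
    unfolding card_twist_AB[OF assms] card_power_eq_iff using W2(3) by auto
qed

text \<open>The offsets 0, 1 and 2 turn the intersection dimensions \<open>e\<close>,
  \<open>e - 1\<close> and \<open>e - 2\<close> of the three adjacency rules into the single
  exponent \<open>e\<close>.\<close>

lemma twisted_arc_iff:
  assumes "W1 \<in> \<A> \<union> \<B>" "W2 \<in> \<A> \<union> \<B>"
  shows "(W1, W2) \<in> parcs (twisted_grassmann_graph scale H e)
    \<longleftrightarrow> card (twist H \<sigma> W1 \<inter> twist H \<sigma> W2) = CARD('k) ^ e"
proof -
  \<comment> \<open>Disjointness of the two classes leaves only one clause of the arc set applicable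
    to each pair.\<close>
  have disj: "\<not> (W \<in> \<A> \<and> W \<in> \<B>)" for W
    using twisted_A_D(3) twisted_B_D(2) by blast
  consider "W1 \<in> \<A>" "W2 \<in> \<A>" | "W1 \<in> \<A>" "W2 \<in> \<B>" | "W1 \<in> \<B>" "W2 \<in> \<A>" | "W1 \<in> \<B>" "W2 \<in> \<B>"
    using assms by auto
  then show ?thesis
  proof cases
    case 1
    then show ?thesis
      using disj[of W1] disj[of W2] card_twist_AA[OF 1] card_power_eq_iff
      by (auto simp: twisted_grassmann_graph_def)
  next
    case 2
    then show ?thesis
      using disj[of W1] disj[of W2] adjacent_AB_iff[OF 2]
      by (auto simp: twisted_grassmann_graph_def)
  next
    case 3
    then show ?thesis
      using disj[of W1] disj[of W2] adjacent_AB_iff[OF 3(2,1)]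
      by (auto simp: twisted_grassmann_graph_def Int_commute)
  next
    case 4
    have "dim (W1 \<inter> W2) + 2 = e \<longleftrightarrow> dim (W1 \<inter> W2) = e - 2"
      using e by auto
    then show ?thesis
      unfolding card_twist_BB[OF 4] card_power_eq_iff
      using 4 disj[of W1] disj[of W2] by (auto simp: twisted_grassmann_graph_def)
  qed
qed

section \<open>From twisted sets to blocks\<close>

lemma proj_points_twist_Int:
  "proj_points scale (twist H \<sigma> W1) \<inter> proj_points scale (twist H \<sigma> W2)
    = proj_points scale (twist H \<sigma> W1 \<inter> twist H \<sigma> W2)"
  by (auto simp: proj_points_def grassmannian_def)

lemma card_block_Int_eq_iff:
  assumes "W1 \<in> \<A> \<union> \<B>" "W2 \<in> \<A> \<union> \<B>"
  shows "real (card (proj_points scale (twist H \<sigma> W1) \<inter> proj_points scale (twist H \<sigma> W2)))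
      = (real CARD('k) ^ k - 1) / (real CARD('k) - 1)
    \<longleftrightarrow> card (twist H \<sigma> W1 \<inter> twist H \<sigma> W2) = CARD('k) ^ k"
  unfolding proj_points_twist_Int
  using twist_cone[OF assms(1)] twist_cone[OF assms(2)]
  by (intro card_proj_points_eq_iff) auto

lemma inj_on_blocks: "inj_on (\<lambda>W. proj_points scale (twist H \<sigma> W)) (\<A> \<union> \<B>)"
proof (rule inj_onI)
  fix W1 W2 assume W: "W1 \<in> \<A> \<union> \<B>" "W2 \<in> \<A> \<union> \<B>"
    and eq: "proj_points scale (twist H \<sigma> W1) = proj_points scale (twist H \<sigma> W2)"
  show "W1 = W2"
    \<comment> \<open>If the blocks coincide, they meet in as many points as the first block meets
      itself, so the pair passes the size test for equality.\<close>
    using twisted_eq_iff[OF W(1,1)] eq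
    unfolding twisted_eq_iff[OF W] card_block_Int_eq_iff[OF W, symmetric]
      card_block_Int_eq_iff[OF W(1,1), symmetric] by simp
qed

text \<open>Within \<open>H\<close>, of dimension 2e, the involution \<open>\<sigma>\<close>
  exchanges dimensions \<open>e - 1\<close> and \<open>e + 1\<close>, so the blocks from
  (e+1)-subspaces of \<open>H\<close> are exactly those of \<B>.\<close>

lemma design_blocks:
  "design_A scale H \<sigma> e \<union> design_B scale H e = (\<lambda>W. proj_points scale (twist H \<sigma> W)) ` (\<A> \<union> \<B>)"
proof -
  have "grassmannian scale H (e + 1) = \<sigma> ` \<B>"
  proof (intro equalityI subsetI)
    fix U assume "U \<in> grassmannian scale H (e + 1)"
    then have U: "subspace U" "U \<subseteq> H" "dim U = e + 1"
      by (auto simp: grassmannian_def)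
    note \<sigma>U = polarity_subspace[OF pol U(1,2)]
    have "\<sigma> U \<in> \<B>"
      using \<sigma>U dim_polarity[OF pol H U(1,2)] U(3) dimH
      by (auto simp: twisted_B_def grassmannian_def)
    then show "U \<in> \<sigma> ` \<B>"
      using \<sigma>U by force
  next
    fix U assume "U \<in> \<sigma> ` \<B>"
    then obtain W where W: "W \<in> \<B>" "U = \<sigma> W" by auto
    note WD = twisted_B_D[OF W(1)]
    show "U \<in> grassmannian scale H (e + 1)"
      using polarity_subspace[OF pol WD(1,2)] dim_polarity[OF pol H WD(1,2)] WD(3) dimH W(2)
      by (auto simp: grassmannian_def)
  qed
  then have "design_B scale H e = (\<lambda>W. proj_points scale (twist H \<sigma> W)) ` \<B>"
    using twist_B by (auto simp: design_B_def)
  moreover have "design_A scale H \<sigma> e = (\<lambda>W. proj_points scale (twist H \<sigma> W)) ` \<A>"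
    by (auto simp: design_A_def twist_def)
  ultimately show ?thesis
    by (simp add: image_Un)
qed

lemma digraph_iso_block_graph:
  "digraph_iso (with_proj (twisted_grassmann_graph scale H e))
    (with_proj (block_graph ((real CARD('k) ^ e - 1) / (real CARD('k) - 1))
      (polarity_design scale H \<sigma> e)))"
proof (rule digraph_iso_with_projI[where f = "\<lambda>W. proj_points scale (twist H \<sigma> W)"], goal_cases)
  case 1
  then show ?case
    using inj_on_blocks by (simp add: twisted_grassmann_graph_def)
next
  case 2
  then show ?case
    using design_blocks
    by (simp add: twisted_grassmann_graph_def block_graph_def polarity_design_def)
next
  case 3
  then show ?case
    by (auto simp: twisted_grassmann_graph_def)
next
  case 4
  then show ?case
    by (auto simp: block_graph_def)
next
  case (5 W1 W2)
  then have W: "W1 \<in> \<A> \<union> \<B>" "W2 \<in> \<A> \<union> \<B>"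
    by (auto simp: twisted_grassmann_graph_def)
  \<comment> \<open>Arcs of \<open>block_graph\<close> join distinct blocks. Adjacency already
    implies this, since equal vertices would give exponent \<open>e + 1\<close> instead of
    \<open>e\<close>.\<close>
  have "W1 \<noteq> W2" if "card (twist H \<sigma> W1 \<inter> twist H \<sigma> W2) = CARD('k) ^ e"
    using that twisted_eq_iff[OF W] card_power_eq_iff[of e "e + 1"] by simp
  then show ?case
    unfolding twisted_arc_iff[OF W] card_block_Int_eq_iff[OF W, symmetric]
    using W inj_onD[OF inj_on_blocks]
    by (auto simp: block_graph_def polarity_design_def design_blocks)
qed

end

theorem theorem1:
  fixes scale :: "'k::{field,finite} \<Rightarrow> 'v::ab_group_add \<Rightarrow> 'v"
    and q e :: nat
    and H :: "'v set"
    and \<sigma> :: "'v set \<Rightarrow> 'v set"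
  assumes "card (UNIV :: 'k set) = q"
    and "e \<ge> 2"
    and "vector_space scale"
    and "vector_space.dim scale (UNIV :: 'v set) = 2 * e + 1"
    and "H \<in> grassmannian scale UNIV (2 * e)"
    and "polarity scale H \<sigma>"
  shows "digraph_iso
    (with_proj (twisted_grassmann_graph scale H e))
    (with_proj (block_graph ((real q ^ e - 1) / (real q - 1))
      (polarity_design scale H \<sigma> e)))"
proof -
  interpret vector_space scale by fact
  obtain B where B: "independent B" "UNIV \<subseteq> span B" "card B = dim (UNIV :: 'v set)"
    using basis_exists[of UNIV] by blast
  \<comment> \<open>An infinite basis would have cardinality \<open>0\<close>.\<close>
  then have "finite B"
    using assms(4) by (metis add_is_0 card.infinite one_neq_zero)
  interpret twisted_setting scale B H \<sigma> e
    using B \<open>finite B\<close> assms(2,4-6) by unfold_locales (auto simp: grassmannian_def)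
  show ?thesis
    using digraph_iso_block_graph assms(1) by simp
qed

end
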